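(* Let $S_{\boldsymbol\lambda}\in\boldsymbol B(\ell^2(V))$ be a nonzero weighted shift on a directed tree $\mathcal T=(V,E)$ with weights $\boldsymbol\lambda=\{\lambda_v\}_{v\in V^\circ}$. Then $S_{\boldsymbol\lambda}$ is cohyponormal if and only if the tree $\mathcal T$ is rootless and one of the following two (mutually exclusive) conditions holds: (i) there exists a sequence $\{u_n\}_{n=-\infty}^\infty\subseteq V$ such that $$0<|\lambda_{u_n}|\le|\lambda_{u_{n-1}}|\quad\text{and}\quad u_{n-1}=\operatorname{par}(u_n)$$ for all $n\in\mathbb Z$, and $\lambda_v=0$ for all $v\in V\setminus\{u_n:n\in\mathbb Z\}$; (ii) there exists a sequence $\{u_n\}_{n=-\infty}^0\subseteq V$ such that $$0<\sum_{v\in\operatorname{Chi}(u_0)}|\lambda_v|^2\le|\lambda_{u_0}|^2,\quad 0<|\lambda_{u_n}|\le|\lambda_{u_{n-1}}|\quad\text{and}\quad u_{n-1}=\operatorname{par}(u_n)$$ for all integers $n\le0$, and $\lambda_v=0$ for all $v\in V\setminus(\{u_n:n\le0\}\cup\operatorname{Chi}(u_0))$.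
   Context: A directed tree $\mathcal T=(V,E)$ consists of a nonempty set $V$ (of arbitrary cardinality) of vertices and a set $E\subseteq V\times V\setminus\{(v,v):v\in V\}$ of edges such that: (1) any two distinct vertices $u,v$ are joined by an undirected path, i.e. there are $v_1=u,\dots,v_n=v$ in $V$ ($n\ge 2$) with $(v_j,v_{j+1})\in E$ or $(v_{j+1},v_j)\in E$ for each $j<n$; (2) there is no circuit, i.e. no finite sequence of distinct vertices $u_1,\dots,u_n$ ($n\ge2$) with $(u_j,u_{j+1})\in E$ for $j<n$ and $(u_n,u_1)\in E$; (3) every vertex $v$ that is not a root has a unique vertex $\operatorname{par}(v)$ (its parent) with $(\operatorname{par}(v),v)\in E$; a root is a vertex $v$ for which there is no $u$ with $(u,v)\in E$. A directed tree has at most one root, denoted $\mathrm{root}$ when it exists; it is rootless if there is none. $V^\circ$ is $V$ with the root removed (and $V^\circ=V$ if $\mathcal T$ is rootless). $\operatorname{Chi}(u)=\{v\in V:(u,v)\in E\}$. $\ell^2(V)$ is the Hilbert space of square summable complex functions on $V$. For $\boldsymbol\lambda=\{\lambda_v\}_{v\in V^\circ}\subseteq\mathbb C$ and $f\colon V\to\mathbb C$ put $(\Lambda f)(v)=\lambda_v f(\operatorname{par}(v))$ for $v\in V^\circ$ and $(\Lambda f)(\mathrm{root})=0$. The weighted shift $S_{\boldsymbol\lambda}$ is the operator in $\ell^2(V)$ with domain $\{f\in\ell^2(V):\Lambda f\in\ell^2(V)\}$ and $S_{\boldsymbol\lambda}f=\Lambda f$. $\boldsymbol B(\mathcal H)$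 denotes the bounded operators on $\mathcal H$ with domain $\mathcal H$. $A\in\boldsymbol B(\mathcal H)$ is cohyponormal if $A^*$ is hyponormal, i.e. $\|Af\|\le\|A^*f\|$ for all $f\in\mathcal H$. *)

theory Defs
  imports "HOL-Analysis.Analysis"
begin

section \<open>Directed trees\<close>

definition is_root :: "'v set \<Rightarrow> ('v \<times> 'v) set \<Rightarrow> 'v \<Rightarrow> bool" where
  "is_root V E v \<longleftrightarrow> v \<in> V \<and> (\<nexists>u. (u, v) \<in> E)"

locale directed_tree =
  fixes V :: "'v set" and E :: "('v \<times> 'v) set"
  assumes nonempty: "V \<noteq> {}"
    and edges: "E \<subseteq> V \<times> V - {(v, v) | v. v \<in> V}"
    and connected: "\<And>u v. \<lbrakk>u \<in> V; v \<in> V; u \<noteq> v\<rbrakk> \<Longrightarrow>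
      \<exists>p. length p \<ge> 2 \<and> set p \<subseteq> V \<and> hd p = u \<and> last p = v \<and>
        successively (\<lambda>x y. (x, y) \<in> E \<or> (y, x) \<in> E) p"
    and no_circuit: "\<nexists>c. length c \<ge> 2 \<and> set c \<subseteq> V \<and> distinct c \<and>
        successively (\<lambda>x y. (x, y) \<in> E) c \<and> (last c, hd c) \<in> E"
    and unique_parent: "\<And>v. \<lbrakk>v \<in> V; \<not> is_root V E v\<rbrakk> \<Longrightarrow> \<exists>!u. (u, v) \<in> E"

definition rootless :: "'v set \<Rightarrow> ('v \<times> 'v) set \<Rightarrow> bool" where
  "rootless V E \<longleftrightarrow> (\<nexists>v. is_root V E v)"

definition nonroots :: "'v set \<Rightarrow> ('v \<times> 'v) set \<Rightarrow> 'v set" where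
  "nonroots V E = {v \<in> V. \<not> is_root V E v}"

text \<open>Only meaningful at vertices other than the root.\<close>

definition par :: "('v \<times> 'v) set \<Rightarrow> 'v \<Rightarrow> 'v" where
  "par E v = (THE u. (u, v) \<in> E)"

definition Chi :: "('v \<times> 'v) set \<Rightarrow> 'v \<Rightarrow> 'v set" where
  "Chi E u = {v. (u, v) \<in> E}"

section \<open>The Hilbert space of square summable functions on a set\<close>

text \<open>A function on \<open>V\<close> is represented by its extension by zero, so that
  equality of elements is equality of HOL functions.\<close>

definition ell2 :: "'v set \<Rightarrow> ('v \<Rightarrow> complex) set" where
  "ell2 V = {f. (\<forall>v. v \<notin> V \<longrightarrow> f v = 0) \<and> (\<lambda>v. (cmod (f v))\<^sup>2) summable_on V}"

definition ell2_inner :: "'v set \<Rightarrow> ('v \<Rightarrow> complex) \<Rightarrow> ('v \<Rightarrow> complex) \<Rightarrow> complex" where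
  "ell2_inner V f g = (\<Sum>\<^sub>\<infinity>v\<in>V. f v * cnj (g v))"

definition ell2_norm :: "'v set \<Rightarrow> ('v \<Rightarrow> complex) \<Rightarrow> real" where
  "ell2_norm V f = sqrt (\<Sum>\<^sub>\<infinity>v\<in>V. (cmod (f v))\<^sup>2)"

section \<open>Operators\<close>

text \<open>An operator in \<open>ell2 V\<close> need not be everywhere defined; it is a partial map,
  whose domain is \<open>dom A\<close>.\<close>

type_synonym 'v operator = "('v \<Rightarrow> complex) \<rightharpoonup> ('v \<Rightarrow> complex)"

definition bounded_operators :: "'v set \<Rightarrow> 'v operator set" where
  "bounded_operators V = {A. dom A = ell2 V \<and> ran A \<subseteq> ell2 V \<and>
     (\<forall>f\<in>ell2 V. \<forall>g\<in>ell2 V. the (A (\<lambda>v. f v + g v)) = (\<lambda>v. the (A f) v + the (A g) v)) \<and>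
     (\<forall>c. \<forall>f\<in>ell2 V. the (A (\<lambda>v. c * f v)) = (\<lambda>v. c * the (A f) v)) \<and>
     (\<exists>C. \<forall>f\<in>ell2 V. ell2_norm V (the (A f)) \<le> C * ell2_norm V f)}"

definition zero_operator :: "'v set \<Rightarrow> 'v operator" where
  "zero_operator V = (\<lambda>f. if f \<in> ell2 V then Some (\<lambda>_. 0) else None)"

text \<open>The usual adjoint of a densely defined operator; density of \<open>dom A\<close> is what makes
  the vector \<open>h\<close> unique.\<close>

definition adjoint_of :: "'v set \<Rightarrow> 'v operator \<Rightarrow> 'v operator" where
  "adjoint_of V A = (\<lambda>g.
     let is_image = (\<lambda>h. h \<in> ell2 V \<and>
           (\<forall>f\<in>dom A. ell2_inner V (the (A f)) g = ell2_inner V f h))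
     in if g \<in> ell2 V \<and> (\<exists>h. is_image h) then Some (THE h. is_image h) else None)"

definition hyponormal :: "'v set \<Rightarrow> 'v operator \<Rightarrow> bool" where
  "hyponormal V A \<longleftrightarrow> A \<in> bounded_operators V \<and>
     (\<forall>f\<in>ell2 V. ell2_norm V (the (adjoint_of V A f)) \<le> ell2_norm V (the (A f)))"

definition cohyponormal :: "'v set \<Rightarrow> 'v operator \<Rightarrow> bool" where
  "cohyponormal V A \<longleftrightarrow> A \<in> bounded_operators V \<and> hyponormal V (adjoint_of V A)"

section \<open>Weighted shifts on directed trees\<close>

text \<open>The weights are indexed by \<open>nonroots V E\<close>; the operator does not
  depend on the values of \<open>lam\<close> elsewhere.\<close>

definition shift_map ::
  "'v set \<Rightarrow> ('v \<times> 'v) set \<Rightarrow> ('v \<Rightarrow> complex) \<Rightarrow> ('v \<Rightarrow> complex) \<Rightarrow> 'v \<Rightarrow> complex" where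
  "shift_map V E lam f = (\<lambda>v. if v \<in> nonroots V E then lam v * f (par E v) else 0)"

definition weighted_shift ::
  "'v set \<Rightarrow> ('v \<times> 'v) set \<Rightarrow> ('v \<Rightarrow> complex) \<Rightarrow> 'v operator" where
  "weighted_shift V E lam = (\<lambda>f.
     if f \<in> ell2 V \<and> shift_map V E lam f \<in> ell2 V then Some (shift_map V E lam f) else None)"

text \<open>The two alternatives for a cohyponormal weighted shift. In the second one the set of
  children may be infinite; as \<open>infsum\<close> of a non-summable family is \<open>0\<close>, the strict
  positivity of the sum entails summability.\<close>

definition bilateral_chain ::
  "'v set \<Rightarrow> ('v \<times> 'v) set \<Rightarrow> ('v \<Rightarrow> complex) \<Rightarrow> bool" where
  "bilateral_chain V E lam \<longleftrightarrow> (\<exists>u :: int \<Rightarrow> 'v.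
     (\<forall>n. u n \<in> V) \<and>
     (\<forall>n. 0 < cmod (lam (u n)) \<and> cmod (lam (u n)) \<le> cmod (lam (u (n - 1))) \<and>
          u (n - 1) = par E (u n)) \<and>
     (\<forall>v \<in> V - range u. lam v = 0))"

definition terminating_chain ::
  "'v set \<Rightarrow> ('v \<times> 'v) set \<Rightarrow> ('v \<Rightarrow> complex) \<Rightarrow> bool" where
  "terminating_chain V E lam \<longleftrightarrow> (\<exists>u :: int \<Rightarrow> 'v.
     (\<forall>n\<le>0. u n \<in> V) \<and>
     0 < (\<Sum>\<^sub>\<infinity>v\<in>Chi E (u 0). (cmod (lam v))\<^sup>2) \<and>
     (\<Sum>\<^sub>\<infinity>v\<in>Chi E (u 0). (cmod (lam v))\<^sup>2) \<le> (cmod (lam (u 0)))\<^sup>2 \<and>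
     (\<forall>n\<le>0. 0 < cmod (lam (u n)) \<and> cmod (lam (u n)) \<le> cmod (lam (u (n - 1))) \<and>
            u (n - 1) = par E (u n)) \<and>
     (\<forall>v \<in> V - (u ` {..0} \<union> Chi E (u 0)). lam v = 0))"

end

theory Submission
  imports Defs
begin

text \<open>Write \<open>a\<^sub>u\<close> for the sum of \<open>|\<lambda>\<^sub>v|\<^sup>2\<close> over the children \<open>v\<close> of \<open>u\<close>. Then
  \<open>\<parallel>S f\<parallel>\<^sup>2\<close> is the sum of \<open>|f u|\<^sup>2 a\<^sub>u\<close>, and \<open>(S\<^sup>* f) u\<close> is the sum of
  \<open>cnj \<lambda>\<^sub>v * f v\<close> over the children of \<open>u\<close>. Comparing the two norms shows that \<open>S\<close> is
  cohyponormal if and only if every \<open>v\<close> with \<open>a\<^sub>v > 0\<close> has a parent, satisfies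
  \<open>a\<^sub>v \<le> |\<lambda>\<^sub>v|\<^sup>2\<close>, and has only siblings of weight zero. Under this condition the
  set of vertices of nonzero weight is closed under parents and does not branch, except
  possibly at the last step; since any two vertices have a common ancestor, it is a
  single chain.\<close>

section \<open>Square summable functions\<close>

text \<open>The square of \<open>ell2_norm\<close>. Without the root, norms are plain sums that can
  be compared term by term.\<close>

definition sqnorm :: "'v set \<Rightarrow> ('v \<Rightarrow> complex) \<Rightarrow> real" where
  "sqnorm V f = (\<Sum>\<^sub>\<infinity>v\<in>V. (cmod (f v))\<^sup>2)"

lemma sqnorm_nonneg: "0 \<le> sqnorm V f"
  unfolding sqnorm_def by (rule infsum_nonneg) simp

lemma ell2_norm_le_iff: "ell2_norm V f \<le> ell2_norm V g \<longleftrightarrow> sqnorm V f \<le> sqnorm V g"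
  by (simp add: ell2_norm_def sqnorm_def)

lemma ell2_norm_nonneg: "0 \<le> ell2_norm V f"
  using sqnorm_nonneg[of V f] by (simp add: ell2_norm_def sqnorm_def)

lemma ell2_norm_power2: "(ell2_norm V f)\<^sup>2 = sqnorm V f"
  using sqnorm_nonneg[of V f] by (simp add: ell2_norm_def sqnorm_def)

lemma ell2_summable: "f \<in> ell2 V \<Longrightarrow> (\<lambda>v. (cmod (f v))\<^sup>2) summable_on V"
  by (simp add: ell2_def)

lemma ell2_outside: "f \<in> ell2 V \<Longrightarrow> v \<notin> V \<Longrightarrow> f v = 0"
  by (simp add: ell2_def)

lemma square_summable_mult:
  fixes x y :: "'a \<Rightarrow> complex"
  assumes "(\<lambda>v. (cmod (x v))\<^sup>2) summable_on A" "(\<lambda>v. (cmod (y v))\<^sup>2) summable_on A"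
  shows "(\<lambda>v. norm (x v * y v)) summable_on A"
proof -
  have "(\<lambda>v. (cmod (x v))\<^sup>2 + (cmod (y v))\<^sup>2) summable_on A"
    by (intro summable_on_add assms)
  moreover have "norm (x v * y v) \<le> (cmod (x v))\<^sup>2 + (cmod (y v))\<^sup>2" for v
  proof -
    have "0 \<le> cmod (x v) * cmod (y v)" by simp
    then show ?thesis
      using sum_squares_bound[of "cmod (x v)" "cmod (y v)"] unfolding norm_mult by linarith
  qed
  ultimately show ?thesis
    by (intro summable_on_comparison_test[of _ A "\<lambda>v. norm (x v * y v)"]) auto
qed

text \<open>The finite inequality bounds every partial sum of the norms, hence their infinite sum,
  which dominates the norm of the sum.\<close>

lemma infsum_Cauchy_Schwarz:
  fixes x y :: "'a \<Rightarrow> complex"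
  assumes x: "(\<lambda>v. (cmod (x v))\<^sup>2) summable_on A" and y: "(\<lambda>v. (cmod (y v))\<^sup>2) summable_on A"
  shows "(cmod (\<Sum>\<^sub>\<infinity>v\<in>A. x v * y v))\<^sup>2
    \<le> (\<Sum>\<^sub>\<infinity>v\<in>A. (cmod (x v))\<^sup>2) * (\<Sum>\<^sub>\<infinity>v\<in>A. (cmod (y v))\<^sup>2)"
    (is "_ \<le> ?X * ?Y")
proof -
  note abs = square_summable_mult[OF x y]
  have nonneg: "?X \<ge> 0" "?Y \<ge> 0"
    by (auto intro: infsum_nonneg)
  have "(\<Sum>\<^sub>\<infinity>v\<in>A. norm (x v * y v)) \<le> sqrt (?X * ?Y)"
  proof (rule infsum_le_finite_sums[OF abs])
    fix F assume F: "finite F" "F \<subseteq> A"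
    have "(\<Sum>v\<in>F. norm (x v * y v))\<^sup>2 \<le> (\<Sum>v\<in>F. (cmod (x v))\<^sup>2) * (\<Sum>v\<in>F. (cmod (y v))\<^sup>2)"
      unfolding norm_mult by (rule Cauchy_Schwarz_ineq_sum)
    also have "\<dots> \<le> ?X * ?Y"
      by (intro mult_mono finite_sum_le_infsum x y F nonneg sum_nonneg) auto
    finally show "(\<Sum>v\<in>F. norm (x v * y v)) \<le> sqrt (?X * ?Y)"
      by (rule real_le_rsqrt)
  qed
  with norm_infsum_bound[OF abs] have "cmod (\<Sum>\<^sub>\<infinity>v\<in>A. x v * y v) \<le> sqrt (?X * ?Y)"
    by linarith
  then have "(cmod (\<Sum>\<^sub>\<infinity>v\<in>A. x v * y v))\<^sup>2 \<le> (sqrt (?X * ?Y))\<^sup>2"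
    by (intro power_mono) auto
  then show ?thesis
    using nonneg by simp
qed

lemma ell2_add:
  assumes "f \<in> ell2 V" "g \<in> ell2 V"
  shows "(\<lambda>v. f v + g v) \<in> ell2 V"
proof -
  have "(\<lambda>v. 2 * (cmod (f v))\<^sup>2 + 2 * (cmod (g v))\<^sup>2) summable_on V"
    using assms by (intro summable_on_add summable_on_cmult_right ell2_summable)
  moreover have "(cmod (f v + g v))\<^sup>2 \<le> 2 * (cmod (f v))\<^sup>2 + 2 * (cmod (g v))\<^sup>2" for v
  proof -
    have "(cmod (f v + g v))\<^sup>2 \<le> (cmod (f v) + cmod (g v))\<^sup>2"
      by (intro power_mono norm_triangle_ineq) auto
    then show ?thesis
      using sum_squares_bound[of "cmod (f v)" "cmod (g v)"] by (simp add: power2_sum)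
  qed
  ultimately have "(\<lambda>v. (cmod (f v + g v))\<^sup>2) summable_on V"
    by (intro summable_on_comparison_test[of _ V "\<lambda>v. (cmod (f v + g v))\<^sup>2"]) auto
  then show ?thesis
    using assms by (simp add: ell2_def)
qed

lemma ell2_cmult:
  assumes "f \<in> ell2 V"
  shows "(\<lambda>v. c * f v) \<in> ell2 V"
  using assms by (auto simp: ell2_def norm_mult power_mult_distrib intro: summable_on_cmult_right)

lemma ell2_finite_support:
  assumes "finite S" "S \<subseteq> V" "\<And>v. v \<notin> S \<Longrightarrow> f v = 0"
  shows "f \<in> ell2 V"
proof -
  have "(\<lambda>v. (cmod (f v))\<^sup>2) summable_on S"
    using assms(1) by simp
  then have "(\<lambda>v. (cmod (f v))\<^sup>2) summable_on V"
    by (rule summable_on_cong_neutral[THEN iffD1, rotated -1]) (use assms in auto)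
  then show ?thesis
    using assms by (auto simp: ell2_def)
qed

definition unit_vector :: "'v \<Rightarrow> 'v \<Rightarrow> complex" where
  "unit_vector u = (\<lambda>v. if v = u then 1 else 0)"

lemma unit_vector_in_ell2: "u \<in> V \<Longrightarrow> unit_vector u \<in> ell2 V"
  by (rule ell2_finite_support[of "{u}"]) (auto simp: unit_vector_def)

lemma infsum_single:
  fixes f :: "'a \<Rightarrow> 'b::{comm_monoid_add,t2_space}"
  assumes "\<And>v. v \<in> V \<Longrightarrow> v \<noteq> u \<Longrightarrow> f v = 0"
  shows "infsum f V = (if u \<in> V then f u else 0)"
proof -
  have "infsum f V = infsum f (V \<inter> {u})"
    by (rule infsum_cong_neutral) (use assms in auto)
  then show ?thesis by auto
qed

lemma ell2_inner_unit_vector: "u \<in> V \<Longrightarrow> ell2_inner V (unit_vector u) h = cnj (h u)"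
  unfolding ell2_inner_def by (subst infsum_single[of V u]) (auto simp: unit_vector_def)

lemma sqnorm_unit_vector: "u \<in> V \<Longrightarrow> sqnorm V (unit_vector u) = 1"
  unfolding sqnorm_def by (subst infsum_single[of V u]) (auto simp: unit_vector_def)

lemma ell2_inner_commute: "ell2_inner V f g = cnj (ell2_inner V g f)"
  unfolding ell2_inner_def infsum_cnj[symmetric] by (simp add: mult.commute)

section \<open>Everywhere defined operators and their adjoints\<close>

text \<open>Packages a function as an everywhere defined partial map, so that adjoints can be
  computed with functions instead of options.\<close>

definition total_operator :: "'v set \<Rightarrow> (('v \<Rightarrow> complex) \<Rightarrow> 'v \<Rightarrow> complex) \<Rightarrow> 'v operator" where
  "total_operator V F = (\<lambda>f. if f \<in> ell2 V then Some (F f) else None)"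

lemma the_total_operator: "f \<in> ell2 V \<Longrightarrow> the (total_operator V F f) = F f"
  by (simp add: total_operator_def)

lemma dom_total_operator: "dom (total_operator V F) = ell2 V"
  by (auto simp: total_operator_def split: if_splits)

text \<open>Pairing with unit vectors reads off the coordinates on \<open>V\<close>, and elements of
  \<open>ell2 V\<close> vanish elsewhere. So only one vector qualifies as image of \<open>g\<close>,
  and the description in \<open>adjoint_of\<close> picks \<open>B g\<close>.\<close>

lemma adjoint_of_total_operator:
  assumes B: "\<And>g. g \<in> ell2 V \<Longrightarrow> B g \<in> ell2 V"
    and AB: "\<And>f g. f \<in> ell2 V \<Longrightarrow> g \<in> ell2 V \<Longrightarrow> ell2_inner V (A f) g = ell2_inner V f (B g)"
  shows "adjoint_of V (total_operator V A) = total_operator V B"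
proof
  fix g
  show "adjoint_of V (total_operator V A) g = total_operator V B g"
  proof (cases "g \<in> ell2 V")
    case True
    let ?P = "\<lambda>h. h \<in> ell2 V \<and>
      (\<forall>f\<in>ell2 V. ell2_inner V (the (total_operator V A f)) g = ell2_inner V f h)"
    have PB: "?P (B g)"
      using True by (simp add: the_total_operator AB B)
    moreover have "h = B g" if h: "?P h" for h
    proof
      fix v
      show "h v = B g v"
      proof (cases "v \<in> V")
        case v: True
        have "ell2_inner V (unit_vector v) h = ell2_inner V (unit_vector v) (B g)"
          using h PB unit_vector_in_ell2[OF v] by metis
        then show ?thesis
          using v by (simp add: ell2_inner_unit_vector)
      next
        case False
        then show ?thesis
          using h B[OF True] by (metis ell2_outside)
      qed
    qed
    ultimately have "(THE h. ?P h) = B g"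
      by (intro the_equality) blast+
    moreover have "\<exists>h. ?P h"
      using PB by blast
    ultimately show ?thesis
      using True unfolding adjoint_of_def dom_total_operator Let_def by (simp add: total_operator_def)
  qed (simp add: adjoint_of_def total_operator_def)
qed

section \<open>Directed trees\<close>

context directed_tree
begin

text \<open>An edge into \<open>v\<close> shows that \<open>v\<close> is not a root, so its parent
  is unique and the description in \<open>par\<close> denotes it.\<close>

lemma edge_iff_par: "(u, v) \<in> E \<longleftrightarrow> v \<in> nonroots V E \<and> par E v = u"
proof
  assume uv: "(u, v) \<in> E"
  then have v: "v \<in> nonroots V E"
    using edges by (auto simp: nonroots_def is_root_def)
  then have "\<exists>!u. (u, v) \<in> E"
    using unique_parent by (auto simp: nonroots_def)
  then show "v \<in> nonroots V E \<and> par E v = u"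
    using uv v by (auto simp: par_def intro: the1_equality)
next
  assume v: "v \<in> nonroots V E \<and> par E v = u"
  then have "\<exists>!u. (u, v) \<in> E"
    using unique_parent by (auto simp: nonroots_def)
  then show "(u, v) \<in> E"
    using v unfolding par_def by (metis theI)
qed

lemma edge_in_V: "(u, v) \<in> E \<Longrightarrow> u \<in> V" "(u, v) \<in> E \<Longrightarrow> v \<in> V"
  using edges by auto

lemma mem_Chi_iff: "v \<in> Chi E u \<longleftrightarrow> v \<in> nonroots V E \<and> par E v = u"
  by (simp add: Chi_def edge_iff_par)

lemma Chi_subset: "Chi E u \<subseteq> V"
  using edge_in_V by (auto simp: Chi_def)

lemma nonroots_subset: "nonroots V E \<subseteq> V"
  by (auto simp: nonroots_def)

lemma par_in_V: "v \<in> nonroots V E \<Longrightarrow> par E v \<in> V"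
  using edge_iff_par edge_in_V by blast

lemma nonroots_eq: "rootless V E \<Longrightarrow> nonroots V E = V"
  by (auto simp: nonroots_def rootless_def)

text \<open>The sets of children partition the non-roots, since each non-root has exactly one
  parent. This turns sums over non-roots into double sums over parents and their children.\<close>

lemma bij_betw_Sigma_Chi: "bij_betw snd (SIGMA u:V. Chi E u) (nonroots V E)"
  by (auto simp: bij_betw_def inj_on_def mem_Chi_iff image_iff par_in_V)

lemma summable_on_Sigma_Chi_iff:
  "(\<lambda>p. g (snd p)) summable_on (SIGMA u:V. Chi E u) \<longleftrightarrow> g summable_on nonroots V E"
  by (rule summable_on_reindex_bij_betw[OF bij_betw_Sigma_Chi])

lemma infsum_nonroots_eq:
  fixes g :: "'v \<Rightarrow> 'b::banach"
  assumes "g summable_on nonroots V E"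
  shows "infsum g (nonroots V E) = (\<Sum>\<^sub>\<infinity>u\<in>V. \<Sum>\<^sub>\<infinity>v\<in>Chi E u. g v)"
  using assms infsum_Sigma_banach[of "\<lambda>p. g (snd p)" V "Chi E"]
  by (simp add: summable_on_Sigma_Chi_iff infsum_reindex_bij_betw[OF bij_betw_Sigma_Chi])

lemma summable_on_infsum_Chi:
  fixes g :: "'v \<Rightarrow> 'b::banach"
  assumes "g summable_on nonroots V E"
  shows "(\<lambda>u. \<Sum>\<^sub>\<infinity>v\<in>Chi E u. g v) summable_on V"
  using assms summable_on_Sigma_banach[of "\<lambda>u v. g v" V "Chi E"]
  by (simp add: summable_on_Sigma_Chi_iff case_prod_unfold)

text \<open>Carries a common ancestor across one undirected edge. Going down, the path is prolonged.
  Going up to the parent \<open>x\<close> of \<open>y\<close>, either \<open>w = y\<close> and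
  \<open>x\<close> takes its place, or the path from \<open>w\<close> to \<open>y\<close> passes
  through \<open>x\<close>, as parents are unique.\<close>

lemma common_ancestor_edge:
  assumes "(w, y) \<in> E\<^sup>*" "(w, z) \<in> E\<^sup>*" "(x, y) \<in> E \<or> (y, x) \<in> E"
  shows "\<exists>w. (w, x) \<in> E\<^sup>* \<and> (w, z) \<in> E\<^sup>*"
  using assms(3)
proof
  assume "(y, x) \<in> E"
  with assms(1) have "(w, x) \<in> E\<^sup>*" by (rule rtrancl_into_rtrancl)
  with assms(2) show ?thesis by blast
next
  assume xy: "(x, y) \<in> E"
  from assms(1) show ?thesis
  proof (cases rule: rtrancl.cases)
    case rtrancl_refl
    with xy assms(2) have "(x, z) \<in> E\<^sup>*" by (simp add: converse_rtrancl_into_rtrancl)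
    then show ?thesis by blast
  next
    case (rtrancl_into_rtrancl b)
    then have "b = x" using xy by (simp add: edge_iff_par)
    with rtrancl_into_rtrancl assms(2) show ?thesis by blast
  qed
qed

lemma common_ancestor:
  assumes "u \<in> V" "v \<in> V"
  shows "\<exists>w. (w, u) \<in> E\<^sup>* \<and> (w, v) \<in> E\<^sup>*"
proof (cases "u = v")
  case True
  then show ?thesis by (intro exI[of _ u]) simp
next
  case False
  have path: "\<exists>w. (w, hd p) \<in> E\<^sup>* \<and> (w, last p) \<in> E\<^sup>*"
    if "p \<noteq> []" "successively (\<lambda>x y. (x, y) \<in> E \<or> (y, x) \<in> E) p" for p
    using that
  proof (induction p rule: induct_list012)
    case 1
    then show ?case by simp
  next
    case (2 x)
    show ?case by (rule exI[of _ x]) simp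
  next
    case (3 x y zs)
    have xy: "(x, y) \<in> E \<or> (y, x) \<in> E"
      and "successively (\<lambda>x y. (x, y) \<in> E \<or> (y, x) \<in> E) (y # zs)"
      using "3.prems"(2) unfolding successively.simps by argo+
    then obtain w where w: "(w, hd (y # zs)) \<in> E\<^sup>*" "(w, last (y # zs)) \<in> E\<^sup>*"
      using "3.IH"(2) by blast
    show ?case
      using common_ancestor_edge[OF w(1)[simplified] w(2) xy] by (simp only: list.sel last.simps) simp
  qed
  obtain p where "length p \<ge> 2" "hd p = u" "last p = v"
    "successively (\<lambda>x y. (x, y) \<in> E \<or> (y, x) \<in> E) p"
    using connected[OF assms False] by (elim exE conjE)
  then show ?thesis
    using path[of p] by fastforce
qed

lemma ancestor_eq_funpow_par: "(w, v) \<in> E\<^sup>* \<Longrightarrow> \<exists>n. w = (par E ^^ n) v"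
proof (induction rule: converse_rtrancl_induct)
  case base
  show ?case by (rule exI[of _ 0]) simp
next
  case (step y z)
  then obtain n where "z = (par E ^^ n) v" by blast
  then have "y = (par E ^^ Suc n) v"
    using step by (simp add: edge_iff_par)
  then show ?case by blast
qed

text \<open>If iterating \<open>par\<close> led from \<open>v\<close> back to \<open>v\<close>, the
  orbit over the least period would be a circuit.\<close>

lemma funpow_par_neq:
  assumes "rootless V E" "v \<in> V" "0 < k"
  shows "(par E ^^ k) v \<noteq> v"
proof
  assume eq: "(par E ^^ k) v = v"
  have V: "(par E ^^ i) v \<in> V" for i
    by (induction i) (use assms nonroots_eq par_in_V in auto)
  then have edge: "((par E ^^ Suc i) v, (par E ^^ i) v) \<in> E" for i
    using assms by (simp add: edge_iff_par nonroots_eq)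
  define l where "l = (LEAST k. 0 < k \<and> (par E ^^ k) v = v)"
  have l: "0 < l" "(par E ^^ l) v = v"
    using LeastI[of "\<lambda>k. 0 < k \<and> (par E ^^ k) v = v" k] eq assms by (auto simp: l_def)
  have least: "l \<le> m" if "0 < m" "(par E ^^ m) v = v" for m
    unfolding l_def using that by (intro Least_le) simp
  \<comment> \<open>Period one would be a loop, which is excluded by \<open>edges\<close>; circuits
    have length at least two.\<close>
  have "l \<noteq> 1"
    using edge[of 0] l edges by auto
  \<comment> \<open>Applying \<open>par\<close> another \<open>l - j\<close> times to a coincidence
    gives a return to \<open>v\<close> after \<open>l - j + i < l\<close> steps.\<close>
  have neq: "(par E ^^ i) v \<noteq> (par E ^^ j) v" if "i < j" "j < l" for i j
  proof
    assume "(par E ^^ i) v = (par E ^^ j) v"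
    then have "(par E ^^ (l - j + i)) v = (par E ^^ (l - j + j)) v"
      by (simp add: funpow_add)
    then show False
      using least[of "l - j + i"] that l by simp
  qed
  \<comment> \<open>The orbit is listed backwards and ends in \<open>v\<close>, because edges lead
    from parent to child.\<close>
  define c where "c = map (\<lambda>i. (par E ^^ (l - Suc i)) v) [0..<l]"
  have "distinct c"
  proof -
    have "inj_on (\<lambda>i. (par E ^^ (l - Suc i)) v) {0..<l}"
    proof (rule linorder_inj_onI)
      fix i j assume "i < j" "i \<in> {0..<l}" "j \<in> {0..<l}"
      then show "(par E ^^ (l - Suc i)) v \<noteq> (par E ^^ (l - Suc j)) v"
        using neq[of "l - Suc j" "l - Suc i"] by fastforce
    qed auto
    then show ?thesis
      by (simp add: c_def distinct_map)
  qed
  moreover have "successively (\<lambda>x y. (x, y) \<in> E) c"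
    unfolding c_def successively_conv_nth
  proof safe
    fix i assume "Suc i < length (map (\<lambda>i. (par E ^^ (l - Suc i)) v) [0..<l])"
    then show "(map (\<lambda>i. (par E ^^ (l - Suc i)) v) [0..<l] ! i,
        map (\<lambda>i. (par E ^^ (l - Suc i)) v) [0..<l] ! Suc i) \<in> E"
      using edge[of "l - Suc (Suc i)"] by (simp add: Suc_diff_Suc del: funpow.simps)
  qed
  moreover have "(last c, hd c) \<in> E"
  proof -
    have "last c = v" "hd c = (par E ^^ (l - 1)) v"
      using l(1) by (auto simp: c_def last_map hd_map)
    moreover have "(v, (par E ^^ (l - 1)) v) \<in> E"
      using edge[of "l - 1"] l by simp
    ultimately show ?thesis by simp
  qed
  moreover have "length c \<ge> 2" "set c \<subseteq> V"
    using \<open>l \<noteq> 1\<close> l(1) V by (auto simp: c_def)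
  ultimately have "\<exists>c. length c \<ge> 2 \<and> set c \<subseteq> V \<and> distinct c \<and>
      successively (\<lambda>x y. (x, y) \<in> E) c \<and> (last c, hd c) \<in> E"
    by (intro exI[of _ c] conjI)
  with no_circuit show False
    by (rule notE)
qed

text \<open>No edge enters a root, so a common ancestor of \<open>r\<close> and \<open>v\<close> can
  only be \<open>r\<close>.\<close>

lemma root_imp_ancestor:
  assumes "is_root V E r" "v \<in> V"
  shows "(r, v) \<in> E\<^sup>*"
proof -
  obtain w where w: "(w, r) \<in> E\<^sup>*" "(w, v) \<in> E\<^sup>*"
    using assms common_ancestor unfolding is_root_def by blast
  from w(1) have "w = r"
    using assms(1) by (cases rule: rtrancl.cases) (auto simp: is_root_def)
  with w show ?thesis by simp
qed

end

section \<open>The adjoint of a bounded weighted shift\<close>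

locale bounded_weighted_shift = directed_tree V E
  for V :: "'v set" and E :: "('v \<times> 'v) set" +
  fixes lam :: "'v \<Rightarrow> complex"
  assumes bounded: "weighted_shift V E lam \<in> bounded_operators V"
begin

abbreviation shift :: "('v \<Rightarrow> complex) \<Rightarrow> 'v \<Rightarrow> complex" where
  "shift \<equiv> shift_map V E lam"

text \<open>The number \<open>a\<^sub>u\<close> of the overview; by
  \<open>sqnorm_shift_unit_vector\<close> it is the squared norm of the image of the unit vector at
  \<open>u\<close>.\<close>

definition child_weight :: "'v \<Rightarrow> real" where
  "child_weight u = (\<Sum>\<^sub>\<infinity>v\<in>Chi E u. (cmod (lam v))\<^sup>2)"

text \<open>The candidate for the adjoint, confirmed in \<open>adjoint_shift\<close>.\<close>

definition coshift :: "('v \<Rightarrow> complex) \<Rightarrow> 'v \<Rightarrow> complex" where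
  "coshift g = (\<lambda>u. if u \<in> V then \<Sum>\<^sub>\<infinity>v\<in>Chi E u. cnj (lam v) * g v else 0)"

lemma child_weight_nonneg: "0 \<le> child_weight u"
  unfolding child_weight_def by (rule infsum_nonneg) simp

lemma shift_in_ell2:
  assumes "f \<in> ell2 V"
  shows "shift f \<in> ell2 V"
proof -
  have "f \<in> dom (weighted_shift V E lam)"
    using bounded assms by (simp add: bounded_operators_def)
  then show ?thesis
    by (auto simp: weighted_shift_def split: if_splits)
qed

lemma weighted_shift_eq: "weighted_shift V E lam = total_operator V shift"
  using shift_in_ell2 by (auto simp: weighted_shift_def total_operator_def fun_eq_iff)

lemma sqnorm_shift_bound: "\<exists>C\<ge>0. \<forall>f\<in>ell2 V. sqnorm V (shift f) \<le> C * sqnorm V f"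
proof -
  have "\<exists>C. \<forall>f\<in>ell2 V. ell2_norm V (shift f) \<le> C * ell2_norm V f"
    using bounded by (simp add: bounded_operators_def weighted_shift_eq the_total_operator)
  then obtain C where C: "ell2_norm V (shift f) \<le> C * ell2_norm V f" if "f \<in> ell2 V" for f
    by blast
  have "sqnorm V (shift f) \<le> C\<^sup>2 * sqnorm V f" if "f \<in> ell2 V" for f
    using power_mono[OF C[OF that] ell2_norm_nonneg, of 2]
    by (simp add: power_mult_distrib ell2_norm_power2)
  then show ?thesis
    by (intro exI[of _ "C\<^sup>2"]) simp
qed

lemma summable_on_nonroots_shift:
  fixes h :: "complex \<Rightarrow> 'v \<Rightarrow> 'b::banach"
  assumes "\<And>v. h 0 v = 0" "(\<lambda>v. h (shift f v) v) summable_on V"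
  shows "(\<lambda>v. h (lam v * f (par E v)) v) summable_on nonroots V E"
proof -
  have "(\<lambda>v. h (shift f v) v) summable_on nonroots V E"
    by (rule summable_on_subset_banach[OF assms(2) nonroots_subset])
  then show ?thesis
    by (rule summable_on_cong[THEN iffD1, rotated]) (simp add: shift_map_def)
qed

text \<open>As \<open>h 0 v = 0\<close>, a root contributes nothing, and the other vertices are
  grouped by parents. The function \<open>h\<close> is left open so that one lemma yields both the
  norm of \<open>shift f\<close> and its inner products.\<close>

lemma infsum_shift:
  fixes h :: "complex \<Rightarrow> 'v \<Rightarrow> 'b::banach"
  assumes "\<And>v. h 0 v = 0" "(\<lambda>v. h (shift f v) v) summable_on V"
  shows "(\<lambda>u. \<Sum>\<^sub>\<infinity>v\<in>Chi E u. h (lam v * f u) v) summable_on V"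
    and "(\<Sum>\<^sub>\<infinity>v\<in>V. h (shift f v) v) = (\<Sum>\<^sub>\<infinity>u\<in>V. \<Sum>\<^sub>\<infinity>v\<in>Chi E u. h (lam v * f u) v)"
proof -
  let ?g = "\<lambda>v. h (lam v * f (par E v)) v"
  note summable = summable_on_nonroots_shift[OF assms]
  have Chi: "infsum ?g (Chi E u) = (\<Sum>\<^sub>\<infinity>v\<in>Chi E u. h (lam v * f u) v)" for u
    by (rule infsum_cong) (simp add: mem_Chi_iff)
  show "(\<lambda>u. \<Sum>\<^sub>\<infinity>v\<in>Chi E u. h (lam v * f u) v) summable_on V"
    using summable_on_infsum_Chi[OF summable] by (simp only: Chi)
  have "(\<Sum>\<^sub>\<infinity>v\<in>V. h (shift f v) v) = infsum ?g (nonroots V E)"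
    by (rule infsum_cong_neutral) (use nonroots_subset assms(1) in \<open>auto simp: shift_map_def\<close>)
  then show "(\<Sum>\<^sub>\<infinity>v\<in>V. h (shift f v) v) = (\<Sum>\<^sub>\<infinity>u\<in>V. \<Sum>\<^sub>\<infinity>v\<in>Chi E u. h (lam v * f u) v)"
    by (simp only: infsum_nonroots_eq[OF summable] Chi)
qed

lemma
  assumes "f \<in> ell2 V"
  shows summable_shift: "(\<lambda>u. (cmod (f u))\<^sup>2 * child_weight u) summable_on V"
    and sqnorm_shift: "sqnorm V (shift f) = (\<Sum>\<^sub>\<infinity>u\<in>V. (cmod (f u))\<^sup>2 * child_weight u)"
proof -
  have eq: "(\<Sum>\<^sub>\<infinity>v\<in>Chi E u. (cmod (lam v * f u))\<^sup>2) = (cmod (f u))\<^sup>2 * child_weight u" for u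
    unfolding child_weight_def infsum_cmult_right'[symmetric]
    by (simp add: norm_mult power_mult_distrib mult.commute)
  show "(\<lambda>u. (cmod (f u))\<^sup>2 * child_weight u) summable_on V"
    "sqnorm V (shift f) = (\<Sum>\<^sub>\<infinity>u\<in>V. (cmod (f u))\<^sup>2 * child_weight u)"
    using infsum_shift[of "\<lambda>z v. (cmod z)\<^sup>2" f] ell2_summable[OF shift_in_ell2[OF assms]]
    by (simp_all add: eq sqnorm_def)
qed

lemma sqnorm_shift_unit_vector: "u \<in> V \<Longrightarrow> sqnorm V (shift (unit_vector u)) = child_weight u"
  unfolding sqnorm_shift[OF unit_vector_in_ell2]
  by (subst infsum_single[of V u]) (auto simp: unit_vector_def)

text \<open>On the children of \<open>u\<close>, the image of the unit vector at \<open>u\<close>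
  coincides with \<open>lam\<close>. Hence \<open>child_weight u\<close> is a genuine sum and not
  the default value 0 of \<open>infsum\<close>.\<close>

lemma weights_summable_on_Chi: "(\<lambda>v. (cmod (lam v))\<^sup>2) summable_on Chi E u"
proof (cases "u \<in> V")
  case True
  have "(\<lambda>v. (cmod (shift (unit_vector u) v))\<^sup>2) summable_on Chi E u"
    by (rule summable_on_subset_banach[OF ell2_summable Chi_subset])
      (intro shift_in_ell2 unit_vector_in_ell2 True)
  then show ?thesis
    by (rule summable_on_cong[THEN iffD1, rotated])
      (simp add: mem_Chi_iff shift_map_def unit_vector_def)
next
  case False
  then have "Chi E u = {}"
    using edge_in_V by (auto simp: Chi_def)
  then show ?thesis by simp
qed

lemma weight_le_child_weight: "v \<in> Chi E u \<Longrightarrow> (cmod (lam v))\<^sup>2 \<le> child_weight u"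
  unfolding child_weight_def
  using finite_sum_le_infsum[OF weights_summable_on_Chi[of u], of "{v}"] by simp

lemma child_weight_pos_iff: "0 < child_weight u \<longleftrightarrow> (\<exists>v\<in>Chi E u. lam v \<noteq> 0)"
proof
  assume "0 < child_weight u"
  moreover have "child_weight u = 0" if "\<forall>v\<in>Chi E u. lam v = 0"
    unfolding child_weight_def by (rule infsum_0) (use that in simp)
  ultimately show "\<exists>v\<in>Chi E u. lam v \<noteq> 0" by force
next
  assume "\<exists>v\<in>Chi E u. lam v \<noteq> 0"
  then obtain v where "v \<in> Chi E u" "0 < (cmod (lam v))\<^sup>2" by auto
  with weight_le_child_weight[of v u] show "0 < child_weight u" by linarith
qed

lemma child_weight_single:
  assumes "v \<in> Chi E u" "\<And>w. w \<in> Chi E u \<Longrightarrow> w \<noteq> v \<Longrightarrow> lam w = 0"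
  shows "child_weight u = (cmod (lam v))\<^sup>2"
  unfolding child_weight_def by (subst infsum_single[of _ v]) (use assms in auto)

section \<open>The coordinate formula for the adjoint\<close>

lemma ell2_summable_on_Chi: "g \<in> ell2 V \<Longrightarrow> (\<lambda>v. (cmod (g v))\<^sup>2) summable_on Chi E u"
  by (rule summable_on_subset_banach[OF ell2_summable Chi_subset])

lemma coshift_summable:
  assumes "g \<in> ell2 V"
  shows "(\<lambda>v. cnj (lam v) * g v) summable_on Chi E u"
  by (rule abs_summable_summable, rule square_summable_mult)
    (use weights_summable_on_Chi ell2_summable_on_Chi assms in auto)

text \<open>The hypothesis concerns the product, so that it covers both a \<open>g\<close> vanishing
  at the siblings of \<open>v\<close> and siblings of weight zero.\<close>

lemma coshift_single:
  assumes "v \<in> nonroots V E" "\<And>w. w \<in> Chi E (par E v) \<Longrightarrow> w \<noteq> v \<Longrightarrow> cnj (lam w) * g w = 0"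
  shows "coshift g (par E v) = cnj (lam v) * g v"
  using assms par_in_V unfolding coshift_def
  by (subst infsum_single[of _ v]) (auto simp: mem_Chi_iff)

lemma coshift_bound:
  assumes "u \<in> V" "g \<in> ell2 V"
  shows "(cmod (coshift g u))\<^sup>2 \<le> child_weight u * (\<Sum>\<^sub>\<infinity>v\<in>Chi E u. (cmod (g v))\<^sup>2)"
  using infsum_Cauchy_Schwarz[of "\<lambda>v. cnj (lam v)" "Chi E u" g] assms
    weights_summable_on_Chi ell2_summable_on_Chi
  by (simp add: coshift_def child_weight_def)

text \<open>By Cauchy-Schwarz, \<open>(cmod (coshift g u))\<^sup>2\<close> is at most
  \<open>child_weight u\<close> times the mass of \<open>g\<close> on the children of
  \<open>u\<close>. Testing \<open>shift\<close> on unit vectors bounds the child weights by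
  \<open>C\<close>, and the masses add up to at most \<open>sqnorm V g\<close>.\<close>

lemma coshift_ell2_and_bound:
  "\<exists>C. \<forall>g\<in>ell2 V. coshift g \<in> ell2 V \<and> sqnorm V (coshift g) \<le> C * sqnorm V g"
proof -
  obtain C where C: "0 \<le> C" "\<And>f. f \<in> ell2 V \<Longrightarrow> sqnorm V (shift f) \<le> C * sqnorm V f"
    using sqnorm_shift_bound by blast
  have "coshift g \<in> ell2 V \<and> sqnorm V (coshift g) \<le> C * sqnorm V g" if g: "g \<in> ell2 V" for g
  proof -
    let ?s = "\<lambda>u. \<Sum>\<^sub>\<infinity>v\<in>Chi E u. (cmod (g v))\<^sup>2"
    have summable: "(\<lambda>v. (cmod (g v))\<^sup>2) summable_on nonroots V E"
      by (rule summable_on_subset_banach[OF ell2_summable[OF g] nonroots_subset])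
    have le: "(cmod (coshift g u))\<^sup>2 \<le> C * ?s u" if u: "u \<in> V" for u
    proof -
      have "child_weight u \<le> C"
        using C(2)[OF unit_vector_in_ell2[OF u]] u
        by (simp add: sqnorm_shift_unit_vector sqnorm_unit_vector)
      then have "child_weight u * ?s u \<le> C * ?s u"
        by (intro mult_right_mono infsum_nonneg) auto
      with coshift_bound[OF u g] show ?thesis by linarith
    qed
    have s: "(\<lambda>u. C * ?s u) summable_on V"
      by (intro summable_on_cmult_right summable_on_infsum_Chi summable)
    have c: "(\<lambda>u. (cmod (coshift g u))\<^sup>2) summable_on V"
      by (rule summable_on_comparison_test[OF s]) (use le in auto)
    have "sqnorm V (coshift g) \<le> (\<Sum>\<^sub>\<infinity>u\<in>V. C * ?s u)"
      unfolding sqnorm_def by (rule infsum_mono[OF c s le])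
    also have "\<dots> = C * (\<Sum>\<^sub>\<infinity>v\<in>nonroots V E. (cmod (g v))\<^sup>2)"
      by (simp add: infsum_cmult_right' infsum_nonroots_eq[OF summable])
    also have "\<dots> \<le> C * sqnorm V g"
      unfolding sqnorm_def
      by (intro mult_left_mono infsum_mono2 summable ell2_summable g nonroots_subset C(1)) auto
    finally have "sqnorm V (coshift g) \<le> C * sqnorm V g" .
    moreover have "coshift g \<in> ell2 V"
      using c by (auto simp: ell2_def coshift_def)
    ultimately show ?thesis by blast
  qed
  then show ?thesis by blast
qed

lemma coshift_in_ell2: "g \<in> ell2 V \<Longrightarrow> coshift g \<in> ell2 V"
  using coshift_ell2_and_bound by blast

lemma inner_shift:
  assumes f: "f \<in> ell2 V" and g: "g \<in> ell2 V"
  shows "ell2_inner V (shift f) g = ell2_inner V f (coshift g)"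
proof -
  have "(\<lambda>v. shift f v * cnj (g v)) summable_on V"
    by (rule abs_summable_summable, rule square_summable_mult)
      (use ell2_summable[OF shift_in_ell2[OF f]] ell2_summable[OF g] in auto)
  then have "ell2_inner V (shift f) g = (\<Sum>\<^sub>\<infinity>u\<in>V. \<Sum>\<^sub>\<infinity>v\<in>Chi E u. lam v * f u * cnj (g v))"
    unfolding ell2_inner_def by (intro infsum_shift(2)) simp_all
  also have "\<dots> = (\<Sum>\<^sub>\<infinity>u\<in>V. f u * cnj (coshift g u))"
  proof (rule infsum_cong)
    fix u assume "u \<in> V"
    then show "(\<Sum>\<^sub>\<infinity>v\<in>Chi E u. lam v * f u * cnj (g v)) = f u * cnj (coshift g u)"
      by (simp add: coshift_def infsum_cmult_right'[symmetric] mult_ac flip: infsum_cnj)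
  qed
  finally show ?thesis by (simp add: ell2_inner_def)
qed

lemma adjoint_shift: "adjoint_of V (weighted_shift V E lam) = total_operator V coshift"
  unfolding weighted_shift_eq
  by (intro adjoint_of_total_operator coshift_in_ell2 inner_shift)

text \<open>Cohyponormality is hyponormality of the adjoint and so involves the second adjoint,
  computed here from \<open>inner_shift\<close> by conjugate symmetry.\<close>

lemma adjoint_coshift: "adjoint_of V (total_operator V coshift) = total_operator V shift"
proof (intro adjoint_of_total_operator shift_in_ell2)
  fix f g assume "f \<in> ell2 V" "g \<in> ell2 V"
  then show "ell2_inner V (coshift f) g = ell2_inner V f (shift g)"
    using inner_shift[of g f] ell2_inner_commute[of V "coshift f" g] ell2_inner_commute[of V f "shift g"]
    by simp
qed

lemma coshift_bounded: "total_operator V coshift \<in> bounded_operators V"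
proof -
  obtain C where C: "\<And>g. g \<in> ell2 V \<Longrightarrow> coshift g \<in> ell2 V \<and> sqnorm V (coshift g) \<le> C * sqnorm V g"
    using coshift_ell2_and_bound by blast
  \<comment> \<open>In HOL \<open>sqrt\<close> is monotone and multiplicative on all reals, so the
    sign of \<open>C\<close> does not matter.\<close>
  have "ell2_norm V (coshift g) \<le> sqrt C * ell2_norm V g" if "g \<in> ell2 V" for g
    using C[OF that] unfolding ell2_norm_def sqnorm_def[symmetric]
    by (simp flip: real_sqrt_mult)
  moreover have "coshift (\<lambda>v. f v + g v) = (\<lambda>v. coshift f v + coshift g v)"
    if "f \<in> ell2 V" "g \<in> ell2 V" for f g
    using that by (auto simp: coshift_def distrib_left infsum_add coshift_summable fun_eq_iff)
  moreover have "coshift (\<lambda>v. c * f v) = (\<lambda>v. c * coshift f v)" for c f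
    by (auto simp: coshift_def fun_eq_iff mult.left_commute infsum_cmult_right')
  moreover have "ran (total_operator V coshift) \<subseteq> ell2 V"
    using coshift_in_ell2 by (auto simp: total_operator_def ran_def split: if_splits)
  ultimately show ?thesis
    by (auto simp: bounded_operators_def dom_total_operator the_total_operator ell2_add ell2_cmult)
qed

lemma cohyponormal_iff_sqnorm:
  "cohyponormal V (weighted_shift V E lam) \<longleftrightarrow>
    (\<forall>f\<in>ell2 V. sqnorm V (shift f) \<le> sqnorm V (coshift f))"
  using bounded coshift_bounded
  by (simp add: cohyponormal_def hyponormal_def adjoint_shift adjoint_coshift the_total_operator
      ell2_norm_le_iff)

section \<open>Cohyponormality in terms of child weights\<close>

lemma sqnorm_coshift_zero: "(\<And>u. u \<in> V \<Longrightarrow> coshift f u = 0) \<Longrightarrow> sqnorm V (coshift f) = 0"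
  unfolding sqnorm_def by (rule infsum_0) simp

lemma term_le_sqnorm_shift:
  assumes "f \<in> ell2 V" "u \<in> V"
  shows "(cmod (f u))\<^sup>2 * child_weight u \<le> sqnorm V (shift f)"
  unfolding sqnorm_shift[OF assms(1)]
  using finite_sum_le_infsum[OF summable_shift[OF assms(1)], of "{u}"] assms child_weight_nonneg
  by simp

text \<open>Testing on unit vectors bounds the weights from below; testing on vectors supported on
  two siblings and orthogonal to the weights shows that the siblings have weight zero.
  Conversely, the conditions make \<open>par\<close> injective on the vertices with \<open>0 < child_weight v\<close>
  and allow a termwise comparison of the two norms.\<close>

theorem cohyponormal_iff:
  "cohyponormal V (weighted_shift V E lam) \<longleftrightarrow>
    (\<forall>v\<in>V. 0 < child_weight v \<longrightarrow>
      v \<in> nonroots V E \<and> child_weight v \<le> (cmod (lam v))\<^sup>2 \<and>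
      (\<forall>w\<in>Chi E (par E v). w \<noteq> v \<longrightarrow> lam w = 0))"
  (is "?L \<longleftrightarrow> ?R")
proof
  assume ?L
  then have le: "(cmod (f u))\<^sup>2 * child_weight u \<le> sqnorm V (coshift f)"
    if "f \<in> ell2 V" "u \<in> V" for f u
    using that term_le_sqnorm_shift[OF that] by (fastforce simp: cohyponormal_iff_sqnorm)
  show ?R
  proof (intro ballI impI)
    fix v assume v: "v \<in> V" "0 < child_weight v"
    have le_unit: "child_weight v \<le> sqnorm V (coshift (unit_vector v))"
      using le[OF unit_vector_in_ell2 \<open>v \<in> V\<close>, of v] \<open>v \<in> V\<close> by (simp add: unit_vector_def)
    have coshift_other: "coshift (unit_vector v) u = 0" if "v \<notin> Chi E u" for u
      using that by (auto simp: coshift_def unit_vector_def intro!: infsum_0)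
    have nonroot: "v \<in> nonroots V E"
    proof (rule ccontr)
      assume "v \<notin> nonroots V E"
      then have "sqnorm V (coshift (unit_vector v)) = 0"
        by (intro sqnorm_coshift_zero coshift_other) (simp add: mem_Chi_iff)
      with le_unit v show False by simp
    qed
    have "sqnorm V (coshift (unit_vector v)) = (cmod (coshift (unit_vector v) (par E v)))\<^sup>2"
      unfolding sqnorm_def
      by (subst infsum_single[of _ "par E v"])
        (use coshift_other nonroot par_in_V in \<open>auto simp: mem_Chi_iff\<close>)
    also have "coshift (unit_vector v) (par E v) = cnj (lam v)"
      by (subst coshift_single) (auto simp: nonroot unit_vector_def)
    finally have weight: "child_weight v \<le> (cmod (lam v))\<^sup>2"
      using le_unit by simp
    have "lam w = 0" if w: "w \<in> Chi E (par E v)" "w \<noteq> v" for w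
    proof -
      \<comment> \<open>With these values the terms at \<open>v\<close> and \<open>w\<close> cancel
        in \<open>coshift f\<close> at the common parent, the only vertex where they enter.\<close>
      define f where "f = (\<lambda>x. if x = v then cnj (lam w) else if x = w then - cnj (lam v) else 0)"
      have f: "f \<in> ell2 V"
        by (rule ell2_finite_support[of "{v, w}"]) (use v w Chi_subset in \<open>auto simp: f_def\<close>)
      have "coshift f u = 0" if "u \<in> V" for u
      proof (cases "u = par E v")
        case True
        have "(\<Sum>\<^sub>\<infinity>x\<in>Chi E u. cnj (lam x) * f x) = (\<Sum>\<^sub>\<infinity>x\<in>{v, w}. cnj (lam x) * f x)"
          by (rule infsum_cong_neutral) (use True w nonroot in \<open>auto simp: f_def mem_Chi_iff\<close>)
        also have "\<dots> = 0"
          using w by (simp add: f_def)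
        finally show ?thesis by (simp add: coshift_def)
      next
        case False
        then show ?thesis
          using w by (auto simp: coshift_def f_def mem_Chi_iff intro!: infsum_0)
      qed
      then have "(cmod (f v))\<^sup>2 * child_weight v \<le> 0"
        using le[OF f \<open>v \<in> V\<close>] by (simp add: sqnorm_coshift_zero)
      \<comment> \<open>Here \<open>f v\<close> is \<open>cnj (lam w)\<close>, and the factor
        \<open>child_weight v\<close> is positive.\<close>
      then show ?thesis
        using v by (simp add: f_def mult_le_0_iff)
    qed
    with nonroot weight show "v \<in> nonroots V E \<and> child_weight v \<le> (cmod (lam v))\<^sup>2 \<and>
      (\<forall>w\<in>Chi E (par E v). w \<noteq> v \<longrightarrow> lam w = 0)" by blast
  qed
next
  assume R: ?R
  \<comment> \<open>Only the vertices in \<open>T\<close> contribute to the norm of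
    \<open>shift f\<close>.\<close>
  define T where "T = {v \<in> V. 0 < child_weight v}"
  have T: "v \<in> nonroots V E" "child_weight v \<le> (cmod (lam v))\<^sup>2" "lam v \<noteq> 0"
    "w \<in> Chi E (par E v) \<Longrightarrow> w \<noteq> v \<Longrightarrow> lam w = 0" if "v \<in> T" for v w
    using R that by (fastforce simp: T_def)+
  have inj: "inj_on (par E) T"
  proof (rule inj_onI)
    fix v w assume vw: "v \<in> T" "w \<in> T" "par E v = par E w"
    then have "w \<in> Chi E (par E v)"
      using T(1) by (simp add: mem_Chi_iff)
    then show "v = w"
      using T(3,4) vw by blast
  qed
  have "sqnorm V (shift f) \<le> sqnorm V (coshift f)" if f: "f \<in> ell2 V" for f
  proof -
    have T0: "child_weight v = 0" if "v \<in> V - T" for v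
      using that child_weight_nonneg[of v] by (auto simp: T_def)
    have TV: "T \<subseteq> V" "par E ` T \<subseteq> V"
      using T(1) par_in_V by (auto simp: T_def)
    have summable: "(\<lambda>u. (cmod (coshift f u))\<^sup>2) summable_on V"
      by (rule ell2_summable[OF coshift_in_ell2[OF f]])
    then have summable_image: "(\<lambda>u. (cmod (coshift f u))\<^sup>2) summable_on par E ` T"
      by (rule summable_on_subset_banach) (rule TV)
    have "sqnorm V (shift f) = (\<Sum>\<^sub>\<infinity>v\<in>T. (cmod (f v))\<^sup>2 * child_weight v)"
      unfolding sqnorm_shift[OF f] by (rule infsum_cong_neutral) (use T0 TV in auto)
    also have "\<dots> \<le> (\<Sum>\<^sub>\<infinity>v\<in>T. (cmod (coshift f (par E v)))\<^sup>2)"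
    proof (rule infsum_mono)
      show "(\<lambda>v. (cmod (f v))\<^sup>2 * child_weight v) summable_on T"
        by (rule summable_on_subset_banach[OF summable_shift[OF f] TV(1)])
      show "(\<lambda>v. (cmod (coshift f (par E v)))\<^sup>2) summable_on T"
        using summable_image inj by (simp add: summable_on_reindex o_def)
      fix v assume v: "v \<in> T"
      \<comment> \<open>All siblings of \<open>v\<close> have weight zero, so only the term at
        \<open>v\<close> survives.\<close>
      have "coshift f (par E v) = cnj (lam v) * f v"
        by (rule coshift_single) (use T v in auto)
      then show "(cmod (f v))\<^sup>2 * child_weight v \<le> (cmod (coshift f (par E v)))\<^sup>2"
        using mult_left_mono[OF T(2)[OF v], of "(cmod (f v))\<^sup>2"]
        by (simp add: norm_mult power_mult_distrib mult.commute)
    qed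
    also have "\<dots> = (\<Sum>\<^sub>\<infinity>u\<in>par E ` T. (cmod (coshift f u))\<^sup>2)"
      using inj by (simp add: infsum_reindex o_def)
    also have "\<dots> \<le> sqnorm V (coshift f)"
      unfolding sqnorm_def by (rule infsum_mono2[OF summable_image summable TV(2)]) simp
    finally show ?thesis .
  qed
  then show ?L by (simp add: cohyponormal_iff_sqnorm)
qed

end

section \<open>Chains\<close>

text \<open>Here and in \<open>terminating_sequence\<close> the sequence becomes a parameter, so
  that its properties can be projected out as separate facts.\<close>

definition bilateral_sequence ::
  "'v set \<Rightarrow> ('v \<times> 'v) set \<Rightarrow> ('v \<Rightarrow> complex) \<Rightarrow> (int \<Rightarrow> 'v) \<Rightarrow> bool" where
  "bilateral_sequence V E lam u \<longleftrightarrow>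
     (\<forall>n. u n \<in> V) \<and>
     (\<forall>n. 0 < cmod (lam (u n)) \<and> cmod (lam (u n)) \<le> cmod (lam (u (n - 1))) \<and>
          u (n - 1) = par E (u n)) \<and>
     (\<forall>v \<in> V - range u. lam v = 0)"

lemma bilateral_chain_iff: "bilateral_chain V E lam \<longleftrightarrow> (\<exists>u. bilateral_sequence V E lam u)"
  by (simp only: bilateral_chain_def bilateral_sequence_def)

lemma bilateral_sequenceD:
  assumes "bilateral_sequence V E lam u"
  shows "u n \<in> V" "lam (u n) \<noteq> 0" "cmod (lam (u n)) \<le> cmod (lam (u (n - 1)))"
    "u (n - 1) = par E (u n)" "v \<in> V \<Longrightarrow> lam v \<noteq> 0 \<Longrightarrow> \<exists>n. v = u n"
  using assms unfolding bilateral_sequence_def zero_less_norm_iff by blast+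

definition terminating_sequence ::
  "'v set \<Rightarrow> ('v \<times> 'v) set \<Rightarrow> ('v \<Rightarrow> complex) \<Rightarrow> (int \<Rightarrow> 'v) \<Rightarrow> bool" where
  "terminating_sequence V E lam u \<longleftrightarrow>
     (\<forall>n\<le>0. u n \<in> V) \<and>
     0 < (\<Sum>\<^sub>\<infinity>v\<in>Chi E (u 0). (cmod (lam v))\<^sup>2) \<and>
     (\<Sum>\<^sub>\<infinity>v\<in>Chi E (u 0). (cmod (lam v))\<^sup>2) \<le> (cmod (lam (u 0)))\<^sup>2 \<and>
     (\<forall>n\<le>0. 0 < cmod (lam (u n)) \<and> cmod (lam (u n)) \<le> cmod (lam (u (n - 1))) \<and>
            u (n - 1) = par E (u n)) \<and>
     (\<forall>v \<in> V - (u ` {..0} \<union> Chi E (u 0)). lam v = 0)"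

lemma terminating_chain_iff:
  "terminating_chain V E lam \<longleftrightarrow> (\<exists>u. terminating_sequence V E lam u)"
  by (simp only: terminating_chain_def terminating_sequence_def)

lemma terminating_sequenceD:
  assumes "terminating_sequence V E lam u"
  shows "n \<le> 0 \<Longrightarrow> u n \<in> V" "n \<le> 0 \<Longrightarrow> lam (u n) \<noteq> 0"
    "n \<le> 0 \<Longrightarrow> cmod (lam (u n)) \<le> cmod (lam (u (n - 1)))"
    "n \<le> 0 \<Longrightarrow> u (n - 1) = par E (u n)"
    "v \<in> V \<Longrightarrow> lam v \<noteq> 0 \<Longrightarrow> (\<exists>n\<le>0. v = u n) \<or> v \<in> Chi E (u 0)"
    "(\<Sum>\<^sub>\<infinity>v\<in>Chi E (u 0). (cmod (lam v))\<^sup>2) \<le> (cmod (lam (u 0)))\<^sup>2"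
  using assms unfolding terminating_sequence_def zero_less_norm_iff by blast+

section \<open>Chains and the exclusivity of the two alternatives\<close>

context directed_tree
begin

text \<open>The bound \<open>b\<close> lets the lemma serve chains over all integers as well as
  those over \<open>n \<le> 0\<close>.\<close>

lemma chain_eq_funpow_par:
  fixes u :: "int \<Rightarrow> 'v"
  assumes "\<And>n. n \<le> b \<Longrightarrow> u (n - 1) = par E (u n)" "n \<le> b"
  shows "u (n - int k) = (par E ^^ k) (u n)"
proof (induction k)
  case (Suc k)
  have "u (n - int (Suc k)) = u (n - int k - 1)"
    by (simp add: algebra_simps)
  also have "\<dots> = par E (u (n - int k))"
    using assms by simp
  finally show ?case using Suc by simp
qed simp

text \<open>Of two equal members with different indices, one would be a proper iterated parent of
  the other, against \<open>funpow_par_neq\<close>.\<close>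

lemma chain_inj:
  fixes u :: "int \<Rightarrow> 'v"
  assumes "rootless V E" "\<And>n. n \<le> b \<Longrightarrow> u n \<in> V" "\<And>n. n \<le> b \<Longrightarrow> u (n - 1) = par E (u n)"
    and "m \<le> b" "n \<le> b" "u m = u n"
  shows "m = n"
proof -
  have neq: "u m \<noteq> u n" if "m < n" "n \<le> b" for m n
    using chain_eq_funpow_par[of b u n "nat (n - m)"] funpow_par_neq[of "u n" "nat (n - m)"]
      assms(1-3) that by simp
  show ?thesis
    using neq[of m n] neq[of n m] assms(4-6) by (metis linorder_neqE)
qed

text \<open>Let \<open>w 0 = u k\<close>. The terminating chain allows nonzero weights only up to
  the children of \<open>w 0\<close>, while \<open>u (k + 2)\<close> lies two generations below it.
  So \<open>u (k + 2)\<close> would coincide with some \<open>u (k - i)\<close>, or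
  \<open>u (k + 1)\<close> with \<open>u k\<close>.\<close>

lemma not_bilateral_and_terminating:
  assumes rootless: "rootless V E" and "bilateral_chain V E lam" "terminating_chain V E lam"
  shows False
proof -
  obtain u where "bilateral_sequence V E lam u"
    using assms(2) by (auto simp: bilateral_chain_iff)
  note u = bilateral_sequenceD[OF this]
  obtain w where "terminating_sequence V E lam w"
    using assms(3) by (auto simp: terminating_chain_iff)
  note w = terminating_sequenceD[OF this]
  have inj: "m = n" if "u m = u n" for m n
    using chain_inj[of "max m n" u m n] u rootless that by simp
  obtain k where k: "w 0 = u k"
    using u(5)[OF w(1,2)] by auto
  consider j where "j \<le> 0" "u (k + 2) = w j" | "u (k + 2) \<in> Chi E (w 0)"
    using w(5)[OF u(1,2), of "k + 2"] by blast
  then show False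
  proof cases
    case 1
    have "w j = (par E ^^ nat (- j)) (u k)"
      using chain_eq_funpow_par[of 0 w 0 "nat (- j)"] w(4) \<open>j \<le> 0\<close> k by simp
    also have "\<dots> = u (k - int (nat (- j)))"
      using chain_eq_funpow_par[of k u k "nat (- j)"] u(4) by simp
    finally show False
      using inj[of "k + 2" "k - int (nat (- j))"] 1 by simp
  next
    case 2
    then have "u k = u (k + 1)"
      using u(4)[of "k + 2"] k by (simp add: mem_Chi_iff add.commute)
    then show False using inj[of k "k + 1"] by simp
  qed
qed

end

section \<open>Sufficiency of the two conditions\<close>

context bounded_weighted_shift
begin

text \<open>Along the chain, \<open>u n\<close> is the only child of \<open>u (n - 1)\<close> with
  nonzero weight. So the vertices of positive child weight are the members of the chain, and the
  criterion reduces to the monotonicity of the weights.\<close>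

lemma bilateral_chain_imp_cohyponormal:
  assumes rootless: "rootless V E" and "bilateral_chain V E lam"
  shows "cohyponormal V (weighted_shift V E lam)"
  unfolding cohyponormal_iff
proof (intro ballI impI)
  obtain u where "bilateral_sequence V E lam u"
    using assms(2) by (auto simp: bilateral_chain_iff)
  note u = bilateral_sequenceD[OF this]
  have inj: "m = n" if "u m = u n" for m n
    using chain_inj[of "max m n" u m n] u rootless that by simp
  have only_child: "w = u n" if "w \<in> Chi E (u (n - 1))" "lam w \<noteq> 0" for w n
  proof -
    from u(5)[of w] that Chi_subset obtain m where m: "w = u m" by blast
    then have "u (m - 1) = u (n - 1)"
      using that u(4) by (simp add: mem_Chi_iff)
    with inj[of "m - 1" "n - 1"] m show ?thesis by simp
  qed
  have Chi: "u n \<in> Chi E (u (n - 1))" for n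
    using u(1,4) rootless by (simp add: mem_Chi_iff nonroots_eq)
  fix v assume v: "v \<in> V" "0 < child_weight v"
  then obtain w where w: "w \<in> Chi E v" "lam w \<noteq> 0"
    by (auto simp: child_weight_pos_iff)
  with u(5)[of w] Chi_subset obtain n where n: "w = u n" by blast
  with w(1) u(4) have v_eq: "v = u (n - 1)"
    by (simp add: mem_Chi_iff)
  have "child_weight v = (cmod (lam (u n)))\<^sup>2"
    unfolding v_eq by (rule child_weight_single) (use Chi only_child in blast)+
  then have "child_weight v \<le> (cmod (lam v))\<^sup>2"
    using u(3) v_eq by (simp add: power_mono)
  moreover have "\<forall>w\<in>Chi E (par E v). w \<noteq> v \<longrightarrow> lam w = 0"
    using only_child[of _ "n - 1"] u(4)[of "n - 1"] v_eq by auto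
  ultimately show "v \<in> nonroots V E \<and> child_weight v \<le> (cmod (lam v))\<^sup>2 \<and>
      (\<forall>w\<in>Chi E (par E v). w \<noteq> v \<longrightarrow> lam w = 0)"
    using v rootless by (simp add: nonroots_eq)
qed

text \<open>As in the bilateral case, except that \<open>u 0\<close> may have several children of
  nonzero weight; there the bound on the sum of squares takes the place of monotonicity.\<close>

lemma terminating_chain_imp_cohyponormal:
  assumes rootless: "rootless V E" and "terminating_chain V E lam"
  shows "cohyponormal V (weighted_shift V E lam)"
  unfolding cohyponormal_iff
proof (intro ballI impI)
  obtain u where "terminating_sequence V E lam u"
    using assms(2) by (auto simp: terminating_chain_iff)
  note u = terminating_sequenceD[OF this]
  note support = u(5) and last = u(6)[folded child_weight_def]
  have inj: "m = n" if "u m = u n" "m \<le> 0" "n \<le> 0" for m n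
    using chain_inj[of 0 u m n] u rootless that by simp
  have only_child: "w = u n" if "w \<in> Chi E (u (n - 1))" "lam w \<noteq> 0" "n \<le> 0" for w n
  proof -
    from that have "w \<in> V" using Chi_subset by blast
    from support[OF this \<open>lam w \<noteq> 0\<close>] show ?thesis
    proof
      assume "\<exists>m\<le>0. w = u m"
      then obtain m where m: "m \<le> 0" "w = u m" by blast
      then have "u (m - 1) = u (n - 1)"
        using that u(4) by (simp add: mem_Chi_iff)
      with inj[of "m - 1" "n - 1"] m \<open>n \<le> 0\<close> show ?thesis by simp
    next
      \<comment> \<open>Impossible: \<open>w\<close> would have the parents \<open>u 0\<close> and
        \<open>u (n - 1)\<close>, which differ because \<open>n \<le> 0\<close>.\<close>
      assume "w \<in> Chi E (u 0)"
      with that have "u 0 = u (n - 1)" by (simp add: mem_Chi_iff)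
      with inj[of 0 "n - 1"] \<open>n \<le> 0\<close> show ?thesis by simp
    qed
  qed
  have Chi: "u n \<in> Chi E (u (n - 1))" if "n \<le> 0" for n
    using u(1,4) rootless that by (simp add: mem_Chi_iff nonroots_eq)
  fix v assume v: "v \<in> V" "0 < child_weight v"
  then obtain w where w: "w \<in> Chi E v" "lam w \<noteq> 0"
    by (auto simp: child_weight_pos_iff)
  with support[of w] Chi_subset have "(\<exists>n\<le>0. w = u n) \<or> w \<in> Chi E (u 0)" by blast
  then have "\<exists>k\<le>0. v = u k \<and> child_weight v \<le> (cmod (lam v))\<^sup>2"
  proof
    assume "\<exists>n\<le>0. w = u n"
    then obtain n where n: "n \<le> 0" "w = u n" by blast
    with w(1) u(4) have v_eq: "v = u (n - 1)"
      by (simp add: mem_Chi_iff)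
    have "child_weight v = (cmod (lam (u n)))\<^sup>2"
      unfolding v_eq by (rule child_weight_single) (use Chi only_child n in blast)+
    then have "child_weight v \<le> (cmod (lam v))\<^sup>2"
      using u(3) v_eq n by (simp add: power_mono)
    with v_eq n show ?thesis by (intro exI[of _ "n - 1"]) simp
  next
    assume "w \<in> Chi E (u 0)"
    with w(1) last show ?thesis by (intro exI[of _ 0]) (simp add: mem_Chi_iff)
  qed
  then obtain k where k: "k \<le> 0" "v = u k" "child_weight v \<le> (cmod (lam v))\<^sup>2" by blast
  moreover have "\<forall>w\<in>Chi E (par E v). w \<noteq> v \<longrightarrow> lam w = 0"
    using only_child[of _ k] u(4)[of k] k by auto
  ultimately show "v \<in> nonroots V E \<and> child_weight v \<le> (cmod (lam v))\<^sup>2 \<and>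
      (\<forall>w\<in>Chi E (par E v). w \<noteq> v \<longrightarrow> lam w = 0)"
    using v rootless by (simp add: nonroots_eq)
qed

text \<open>Restricted to non-roots, as the value of \<open>lam\<close> at a root is arbitrary and
  does not affect the operator.\<close>

definition support :: "'v set" where
  "support = {v \<in> nonroots V E. lam v \<noteq> 0}"

lemma support_subset: "support \<subseteq> V"
  using nonroots_subset by (auto simp: support_def)

lemma support_nonempty:
  assumes "weighted_shift V E lam \<noteq> zero_operator V"
  shows "support \<noteq> {}"
proof
  assume "support = {}"
  then have "shift f = (\<lambda>_. 0)" for f
    by (auto simp: support_def shift_map_def fun_eq_iff)
  then have "weighted_shift V E lam = zero_operator V"
    by (simp add: weighted_shift_eq total_operator_def zero_operator_def cong: if_cong)
  with assms show False by simp
qed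

end

section \<open>Necessity: the shape of the support\<close>

locale cohyponormal_weighted_shift = bounded_weighted_shift +
  assumes cohyponormal: "cohyponormal V (weighted_shift V E lam)"
begin

text \<open>The parent of \<open>v\<close> has a child of nonzero weight, so the criterion applies
  to the parent; its weight dominates a positive child weight.\<close>

lemma
  assumes "v \<in> support"
  shows par_in_support: "par E v \<in> support"
    and weight_le_weight_par: "cmod (lam v) \<le> cmod (lam (par E v))"
    and child_weight_par_pos: "0 < child_weight (par E v)"
    and child_weight_par_le: "child_weight (par E v) \<le> (cmod (lam (par E v)))\<^sup>2"
proof -
  have v: "v \<in> Chi E (par E v)" "lam v \<noteq> 0" "par E v \<in> V"
    using assms par_in_V by (auto simp: support_def mem_Chi_iff)
  then show pos: "0 < child_weight (par E v)"
    by (auto simp: child_weight_pos_iff)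
  then have p: "par E v \<in> nonroots V E" "child_weight (par E v) \<le> (cmod (lam (par E v)))\<^sup>2"
    using cohyponormal v by (auto simp: cohyponormal_iff)
  then show "child_weight (par E v) \<le> (cmod (lam (par E v)))\<^sup>2" by simp
  from pos p show "par E v \<in> support"
    by (auto simp: support_def)
  from weight_le_child_weight[OF v(1)] p(2) have "(cmod (lam v))\<^sup>2 \<le> (cmod (lam (par E v)))\<^sup>2"
    by linarith
  then show "cmod (lam v) \<le> cmod (lam (par E v))"
    by (rule power2_le_imp_le) simp
qed

text \<open>Branching of the support is possible only among vertices of child weight zero, that is,
  in its last generation.\<close>

lemma sibling_unique:
  assumes "v \<in> V" "0 < child_weight v" "w \<in> support" "par E w = par E v"
  shows "w = v"
proof -
  have "w \<in> Chi E (par E v)" "lam w \<noteq> 0"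
    using assms by (auto simp: support_def mem_Chi_iff)
  then show ?thesis
    using cohyponormal assms(1,2) unfolding cohyponormal_iff by blast
qed

lemma funpow_par_in_support: "v \<in> support \<Longrightarrow> (par E ^^ n) v \<in> support"
  by (induction n) (simp_all add: par_in_support)

text \<open>A root would be an iterated parent of a vertex in the support, hence in the support
  itself, which contains only non-roots.\<close>

lemma support_nonempty_imp_rootless:
  assumes "support \<noteq> {}"
  shows "rootless V E"
  unfolding rootless_def
proof
  assume "\<exists>r. is_root V E r"
  then obtain r where r: "is_root V E r" ..
  obtain v where v: "v \<in> support" using assms by blast
  then have "v \<in> V" using nonroots_subset by (auto simp: support_def)
  with root_imp_ancestor[OF r] ancestor_eq_funpow_par obtain n where "r = (par E ^^ n) v" by blast
  with funpow_par_in_support[OF v] have "r \<in> support" by simp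
  with r show False by (simp add: support_def nonroots_def)
qed

text \<open>Serves to show that a chain exhausts the support. Any \<open>x\<close> in the support
  shares an ancestor with \<open>v\<close>; that ancestor lies in \<open>S\<close>, and membership
  is passed down the path to \<open>x\<close>, all of whose vertices up to \<open>x\<close> can be
  kept in the support because it is closed under parents.\<close>

lemma support_subsetI:
  assumes v: "v \<in> support" and ancestors: "\<And>n. (par E ^^ n) v \<in> S"
    and closed: "\<And>x. x \<in> support \<Longrightarrow> par E x \<in> S \<Longrightarrow> x \<in> S"
  shows "support \<subseteq> S"
proof
  fix x assume x: "x \<in> support"
  obtain w where w: "(w, v) \<in> E\<^sup>*" "(w, x) \<in> E\<^sup>*"
    using common_ancestor[of v x] v x nonroots_subset by (auto simp: support_def)
  from w(2) x show "x \<in> S"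
  proof (induction rule: rtrancl_induct)
    case base
    then show ?case using ancestor_eq_funpow_par[OF w(1)] ancestors by blast
  next
    case (step y z)
    then have "par E z = y" by (simp add: edge_iff_par)
    with step par_in_support closed show ?case by blast
  qed
qed

text \<open>Every vertex of the support has a child in the support, so a chain through
  \<open>v\<close> extends in both directions. It exhausts the support, since a vertex with parent
  \<open>u n\<close> is a sibling of \<open>u (n + 1)\<close>, whose child weight is
  positive.\<close>

lemma bilateral_chainI:
  assumes v: "v \<in> support" and pos: "\<And>x. x \<in> support \<Longrightarrow> 0 < child_weight x"
  shows "bilateral_chain V E lam"
proof -
  define c where "c x = (SOME y. y \<in> support \<and> par E y = x)" for x
  have c: "c x \<in> support" "par E (c x) = x" if "x \<in> support" for x
  proof -
    from pos[OF that] have "\<exists>y. y \<in> support \<and> par E y = x"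
      by (auto simp: child_weight_pos_iff mem_Chi_iff support_def)
    then have "c x \<in> support \<and> par E (c x) = x"
      unfolding c_def by (rule someI_ex)
    then show "c x \<in> support" "par E (c x) = x" by auto
  qed
  \<comment> \<open>Nonnegative indices descend from \<open>u 0 = v\<close> by chosen children,
    negative ones climb by \<open>par\<close>.\<close>
  define u :: "int \<Rightarrow> 'a" where
    "u n = (if 0 \<le> n then (c ^^ nat n) v else (par E ^^ nat (- n)) v)" for n
  have c_funpow: "(c ^^ k) v \<in> support" for k
    by (induction k) (simp_all add: v c)
  have u_support: "u n \<in> support" for n
    by (simp add: u_def c_funpow funpow_par_in_support[OF v])
  have u_par: "u (n - 1) = par E (u n)" for n
  proof (cases "0 < n")
    case True
    then have "nat n = Suc (nat (n - 1))" by simp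
    then show ?thesis using True c(2)[OF c_funpow] by (simp add: u_def)
  next
    case False
    then have "nat (- (n - 1)) = Suc (nat (- n))" by simp
    then show ?thesis using False by (auto simp: u_def)
  qed
  have "support \<subseteq> range u"
  proof (rule support_subsetI[OF v])
    fix n
    have "(par E ^^ n) v = u (- int n)" by (simp add: u_def)
    then show "(par E ^^ n) v \<in> range u" by simp
  next
    fix x assume x: "x \<in> support" "par E x \<in> range u"
    then obtain n where "par E x = u n" by blast
    then have eq: "par E x = par E (u (n + 1))"
      using u_par[of "n + 1"] by simp
    have "x = u (n + 1)"
      by (rule sibling_unique[OF _ pos[OF u_support] x(1) eq])
        (use u_support support_subset in blast)
    then show "x \<in> range u" by simp
  qed
  moreover have "nonroots V E = V"
    using support_nonempty_imp_rootless v by (intro nonroots_eq) blast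
  ultimately have u_complement: "\<forall>x\<in>V - range u. lam x = 0"
    by (auto simp: support_def)
  have u_V: "u n \<in> V" and u_weight: "0 < cmod (lam (u n))" for n
    using u_support[of n] nonroots_subset by (auto simp: support_def)
  have u_decreasing: "cmod (lam (u n)) \<le> cmod (lam (u (n - 1)))" for n
    using weight_le_weight_par[OF u_support, of n] by (simp only: u_par)
  show ?thesis
    unfolding bilateral_chain_def
    by (intro exI[of _ u] conjI allI) (rule u_V u_weight u_decreasing u_par u_complement)+
qed

text \<open>Here \<open>v\<close> lies in the last generation. The chain ends at its parent, so that
  \<open>v\<close> and any siblings of nonzero weight fall under \<open>Chi E (u 0)\<close>.\<close>

lemma terminating_chainI:
  assumes v: "v \<in> support" and leaf: "\<not> 0 < child_weight v"
  shows "terminating_chain V E lam"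
proof -
  \<comment> \<open>The additional \<open>Suc\<close> makes \<open>u 0\<close> the parent of
    \<open>v\<close> rather than \<open>v\<close> itself.\<close>
  define u :: "int \<Rightarrow> 'a" where "u n = (par E ^^ Suc (nat (- n))) v" for n
  have u_support: "u n \<in> support" for n
    unfolding u_def by (rule funpow_par_in_support[OF v])
  have u_pos: "0 < child_weight (u n)" for n
    using child_weight_par_pos[OF funpow_par_in_support[OF v]] by (simp add: u_def)
  have u_par: "u (n - 1) = par E (u n)" if "n \<le> 0" for n
  proof -
    have "nat (- (n - 1)) = Suc (nat (- n))" using that by simp
    then show ?thesis by (simp add: u_def)
  qed
  have u0: "u 0 = par E v" by (simp add: u_def)
  have v_Chi: "v \<in> Chi E (u 0)"
    using v u0 by (simp add: mem_Chi_iff support_def)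
  have "support \<subseteq> u ` {..0} \<union> Chi E (u 0)"
  proof (rule support_subsetI[OF v])
    fix n
    show "(par E ^^ n) v \<in> u ` {..0} \<union> Chi E (u 0)"
    proof (cases n)
      case 0
      then show ?thesis using v_Chi by simp
    next
      case (Suc m)
      then have "(par E ^^ n) v = u (- int m)" by (simp add: u_def)
      then show ?thesis by simp
    qed
  next
    fix x assume x: "x \<in> support" "par E x \<in> u ` {..0} \<union> Chi E (u 0)"
    from x(2) consider n where "n \<le> 0" "par E x = u n" | "par E x \<in> Chi E (u 0)"
      by blast
    then show "x \<in> u ` {..0} \<union> Chi E (u 0)"
    proof cases
      case n: 1
      show ?thesis
      proof (cases "n = 0")
        case True
        then show ?thesis using n x(1) by (simp add: mem_Chi_iff support_def)
      next
        case False
        with n(1) have n1: "n + 1 \<le> 0" by linarith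
        from u_par[OF n1] n(2) have eq: "par E x = par E (u (n + 1))"
          by (simp only: add_diff_cancel_right')
        have "x = u (n + 1)"
          by (rule sibling_unique[OF _ u_pos x(1) eq]) (use u_support support_subset in blast)
        then show ?thesis using n1 by blast
      qed
    next
      case 2
      \<comment> \<open>Now \<open>par E x\<close> is a sibling of \<open>v\<close> with positive
        child weight, so it equals \<open>v\<close>, although \<open>v\<close> has child weight
        zero.\<close>
      then have eq: "par E v = par E (par E x)"
        using u0 by (simp add: mem_Chi_iff)
      have "v = par E x"
        by (rule sibling_unique[OF _ child_weight_par_pos[OF x(1)] v eq])
          (use par_in_support[OF x(1)] support_subset in blast)
      with child_weight_par_pos[OF x(1)] leaf show ?thesis by simp
    qed
  qed
  moreover have "nonroots V E = V"
    using support_nonempty_imp_rootless v by (intro nonroots_eq) blast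
  ultimately have u_complement: "\<forall>x\<in>V - (u ` {..0} \<union> Chi E (u 0)). lam x = 0"
    by (auto simp: support_def)
  have u_V: "u n \<in> V" and u_weight: "0 < cmod (lam (u n))" for n
    using u_support[of n] nonroots_subset by (auto simp: support_def)
  have u_decreasing: "cmod (lam (u n)) \<le> cmod (lam (u (n - 1)))" if "n \<le> 0" for n
    using weight_le_weight_par[OF u_support, of n] by (simp only: u_par[OF that])
  have u_last: "child_weight (u 0) \<le> (cmod (lam (u 0)))\<^sup>2"
    using child_weight_par_le[OF v] by (simp only: u0)
  show ?thesis
    unfolding terminating_chain_def child_weight_def[symmetric]
    by (intro exI[of _ u] conjI allI impI)
      (rule u_V u_weight u_pos u_last u_complement | (rule u_decreasing u_par, assumption))+
qed

end

theorem theorem5p2p2: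
  fixes V :: "'v set" and E :: "('v \<times> 'v) set" and lam :: "'v \<Rightarrow> complex"
  assumes "directed_tree V E"
    and "weighted_shift V E lam \<in> bounded_operators V"
    and "weighted_shift V E lam \<noteq> zero_operator V"
  shows "(cohyponormal V (weighted_shift V E lam) \<longleftrightarrow>
            rootless V E \<and> (bilateral_chain V E lam \<or> terminating_chain V E lam)) \<and>
         (rootless V E \<longrightarrow> \<not> (bilateral_chain V E lam \<and> terminating_chain V E lam))"
proof -
  interpret bounded_weighted_shift V E lam
    using assms by (simp add: bounded_weighted_shift_def bounded_weighted_shift_axioms_def)
  obtain v where v: "v \<in> support"
    using support_nonempty assms(3) by blast
  have "rootless V E \<and> (bilateral_chain V E lam \<or> terminating_chain V E lam)"
    if "cohyponormal V (weighted_shift V E lam)"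
  proof -
    interpret cohyponormal_weighted_shift V E lam
      by unfold_locales (rule that)
    show ?thesis
      \<comment> \<open>Either all vertices of the support have positive child weight and the chain
        is bilateral, or one of them does not and \<open>terminating_chainI\<close> applies to
        it.\<close>
      using v support_nonempty_imp_rootless bilateral_chainI terminating_chainI by blast
  qed
  then show ?thesis
    using bilateral_chain_imp_cohyponormal terminating_chain_imp_cohyponormal
      not_bilateral_and_terminating by blast
qed


end
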